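(* Let $\widetilde{F}:\mathbb{R}^m\to\mathbb{R}$ be $L$-smooth and bounded below. Let $c_1'>0$ and $c_2'>0$ be constants, $\mathbf{z}_0\in\mathbb{R}^m$, and let $(\mathbf{z}_k)_{k\in\mathbb{N}_0}$ be generated by $\mathbf{z}_{k+1}=\mathbf{z}_k+t_k\mathbf{s}_k$ for all $k\in\mathbb{N}_0$, where $t_k>0$ and the directions $\mathbf{s}_k\in\mathbb{R}^m$ satisfy, for all $k\in\mathbb{N}_0$, $$c_1'\|\overline{\nabla}\widetilde{F}(\mathbf{z}_k)\|_2^2\le -\overline{\nabla}\widetilde{F}(\mathbf{z}_k)^T\mathbf{s}_k,\qquad \|\mathbf{s}_k\|_2\le c_2'\|\overline{\nabla}\widetilde{F}(\mathbf{z}_k)\|_2 .$$ Let $(\delta_k)_{k\in\mathbb{N}_0}$ be a non-negative summable sequence such that $\|\overline{\nabla}\widetilde{F}(\mathbf{z}_k)-\nabla\widetilde{F}(\mathbf{z}_k)\|_2\le\delta_k$ for all $k\in\mathbb{N}_0$. If $$\sum_{k=0}^{\infty}t_k^2<\infty\qquad\text{and}\qquad\sum_{k=0}^{\infty}t_k=\infty,$$ then $$\lim_{k\to\infty}\overline{\nabla}\widetilde{F}(\mathbf{z}_k)=\mathbf{0}\qquad\text{and}\qquad\lim_{k\to\infty}\nabla\widetilde{F}(\mathbf{z}_k)=\mathbf{0}\quad\text{in }\mathbb{R}^m .$$ Furthermore, every limit point of $(\mathbf{z}_k)_{k\in\mathbb{N}_0}$ is a stationary point of $\widetilde{F}$.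
   Context: $L$-smooth means that $\widetilde{F}$ is differentiable on $\mathbb{R}^m$ and $\|\nabla\widetilde{F}(\mathbf{x})-\nabla\widetilde{F}(\mathbf{z})\|_2\le L\|\mathbf{x}-\mathbf{z}\|_2$ for all $\mathbf{x},\mathbf{z}\in\mathbb{R}^m$, with $L\ge 0$. For each $k$, $\overline{\nabla}\widetilde{F}(\mathbf{z}_k)\in\mathbb{R}^m$ denotes the inexact gradient available at $\mathbf{z}_k$, an approximation of the exact gradient $\nabla\widetilde{F}(\mathbf{z}_k)$ about which nothing is assumed beyond the conditions in the statement. $\mathbb{N}_0=\{0,1,2,\dots\}$. A limit point of a sequence is the limit of some subsequence. A stationary point is a point where the exact gradient $\nabla\widetilde{F}$ vanishes. *)

theory Defs
  imports "HOL-Analysis.Analysis"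
begin

text \<open>The gradient as a vector with respect to the standard inner product. It is unspecified at
  points where \<open>f\<close> is not differentiable, so it is only used together with differentiability.\<close>

definition gradient :: "('a::euclidean_space \<Rightarrow> real) \<Rightarrow> 'a \<Rightarrow> 'a" where
  "gradient f x = (THE D. GDERIV f x :> D)"

lemma gradient_eqI:
  assumes "GDERIV f x :> D"
  shows "gradient f x = D"
proof -
  have "D' = D" if "GDERIV f x :> D'" for D'
  proof -
    have "(\<lambda>h. inner h D') = (\<lambda>h. inner h D)"
      using has_derivative_unique that assms unfolding gderiv_def by blast
    then have "inner (D' - D) (D' - D) = 0"
      by (metis inner_diff_right right_minus_eq)
    then show ?thesis by simp
  qed
  then show ?thesis
    unfolding gradient_def using assms by (blast intro: the_equality)
qed

lemma GDERIV_gradient: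
  assumes "f differentiable (at x)"
  shows "GDERIV f x :> gradient f x"
proof -
  obtain f' where f': "(f has_derivative f') (at x)"
    using assms unfolding differentiable_def by blast
  then have "linear f'"
    by (rule has_derivative_linear)
  have "f' h = inner h (\<Sum>b\<in>Basis. f' b *\<^sub>R b)" for h
  proof -
    have "f' h = f' (\<Sum>b\<in>Basis. inner h b *\<^sub>R b)"
      by (simp add: euclidean_representation)
    also have "\<dots> = (\<Sum>b\<in>Basis. inner h b * f' b)"
      using \<open>linear f'\<close> by (simp add: linear_sum linear_cmul)
    finally show ?thesis
      by (simp add: inner_sum_right mult.commute)
  qed
  then have "f' = (\<lambda>h. inner h (\<Sum>b\<in>Basis. f' b *\<^sub>R b))"
    by blast
  then have "GDERIV f x :> (\<Sum>b\<in>Basis. f' b *\<^sub>R b)"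
    using f' unfolding gderiv_def by simp
  then show ?thesis
    using gradient_eqI by metis
qed

definition L_smooth :: "real \<Rightarrow> ('a::euclidean_space \<Rightarrow> real) \<Rightarrow> bool" where
  "L_smooth L f \<longleftrightarrow>
     0 \<le> L \<and> (\<forall>x. f differentiable (at x)) \<and>
     (\<forall>x z. norm (gradient f x - gradient f z) \<le> L * norm (x - z))"

definition stationary_point :: "('a::euclidean_space \<Rightarrow> real) \<Rightarrow> 'a \<Rightarrow> bool" where
  "stationary_point f x \<longleftrightarrow> f differentiable (at x) \<and> gradient f x = 0"

text \<open>Limit points of a sequence are subsequential limits; this differs from accumulation points of
  the range (\<open>islimpt\<close>), e.g. for a constant sequence.\<close>

definition seq_limit_point :: "(nat \<Rightarrow> 'a::topological_space) \<Rightarrow> 'a \<Rightarrow> bool" where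
  "seq_limit_point z x \<longleftrightarrow> (\<exists>r. strict_mono r \<and> (z \<circ> r) \<longlonglongrightarrow> x)"

end

theory Submission
  imports Defs
begin

text \<open>Since \<open>t \<longlonglongrightarrow> 0\<close>, the descent inequality and Young's inequality for the gradient error show
  that \<open>F (z k)\<close> eventually decreases by \<open>c1 / 2 * t k * norm (g k) ^ 2\<close> up to a summable error, so
  \<open>t k * norm (g k) ^ 2\<close> is summable. To exclude oscillation of \<open>norm (g k)\<close>, truncate it from below at
  a level \<open>c > 0\<close>: by \<open>L\<close>-smoothness the truncated sequence has summably bounded increments, hence
  converges, and its limit must be \<open>c\<close> because \<open>t\<close> is not summable.\<close>

text \<open>Telescoping bounds the partial sums of \<open>b\<close> by a starting value, the bounded
  partial sums of \<open>e\<close> and the lower bound \<open>m\<close>. Summability will be applied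
  to function values along the iterates, convergence to truncated gradient norms.\<close>

lemma almost_decreasing:
  fixes u b e :: "nat \<Rightarrow> real"
  assumes step: "\<forall>\<^sub>F k in sequentially. u (Suc k) + b k \<le> u k + e k"
    and b: "\<And>k. 0 \<le> b k" and e: "summable e" and u: "\<And>k. m \<le> u k"
  shows almost_decreasing_summable: "summable b"
    and almost_decreasing_convergent: "convergent u"
proof -
  obtain N where N: "\<And>k. N \<le> k \<Longrightarrow> u (Suc k) + b k \<le> u k + e k"
    using step unfolding eventually_sequentially by blast
  have eN: "summable (\<lambda>i. e (i + N))"
    using e by (simp add: summable_iff_shift)
  obtain B where B: "\<And>n. (\<Sum>i<n. e (i + N)) \<le> B"
    using summable_imp_sums_bounded[OF eN] bounded_imp_bdd_above
    unfolding bdd_above_def by (metis rangeI)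
  have telescope: "u (n + N) + (\<Sum>i<n. b (i + N)) \<le> u N + (\<Sum>i<n. e (i + N))" for n
  proof (induction n)
    case (Suc n)
    then show ?case using N[of "n + N"] by simp
  qed simp
  have "summable (\<lambda>i. b (i + N))"
  proof (rule bounded_imp_summable)
    show "(\<Sum>i\<le>n. b (i + N)) \<le> u N + B - m" for n
      using telescope[of "Suc n"] B[of "Suc n"] u[of "Suc n + N"] by (simp add: lessThan_Suc_atMost)
  qed (use b in auto)
  then show "summable b"
    by (simp add: summable_iff_shift)
  \<comment> \<open>Subtracting the accumulated errors turns the almost decreasing \<open>u\<close>
    into a truly decreasing sequence.\<close>
  let ?w = "\<lambda>n. u (n + N) - (\<Sum>i<n. e (i + N))"
  have "convergent ?w"
  proof (rule Bseq_monoseq_convergent)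
    have dec: "decseq ?w"
      using N b by (intro decseq_SucI) (smt (verit) add_Suc le_add2 sum.lessThan_Suc)
    then show "monoseq ?w"
      by (rule decseq_imp_monoseq)
    \<comment> \<open>\<open>?w\<close> lies between \<open>m - B\<close> and its first value
      \<open>?w 0\<close>.\<close>
    show "Bseq ?w"
    proof (rule BseqI'[where K = "\<bar>m - B\<bar> + \<bar>?w 0\<bar>"])
      show "norm (?w n) \<le> \<bar>m - B\<bar> + \<bar>?w 0\<bar>" for n
        using B[of n] u[of "n + N"] decseqD[OF dec, of 0 n] by simp
    qed
  qed
  moreover have "convergent (\<lambda>n. \<Sum>i<n. e (i + N))"
    using eN summable_iff_convergent by blast
  ultimately have "convergent (\<lambda>n. ?w n + (\<Sum>i<n. e (i + N)))"
    by (rule convergent_add)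
  then show "convergent u"
    by (simp add: convergent_ignore_initial_segment)
qed

lemma divergent_sum_not_summable:
  fixes t :: "nat \<Rightarrow> real"
  assumes "filterlim (\<lambda>n. \<Sum>k<n. t k) at_top sequentially"
  shows "\<not> summable t"
  using assms filterlim_at_top_imp_at_infinity not_tendsto_and_filterlim_at_infinity
    sequentially_bot summable_LIMSEQ by blast

text \<open>Summability of \<open>t k * (a k)\<^sup>2\<close> without that of \<open>t\<close> only
  keeps \<open>a\<close> from staying above a positive level forever. The bound \<open>step\<close>
  excludes later returns: its increments \<open>C * t k * a k\<close> need not be summable, but
  where \<open>a k\<close> exceeds a fixed positive level they are dominated by a multiple of
  \<open>t k * (a k)\<^sup>2\<close>.\<close>

lemma tendsto_zero_of_weighted_square_summable:
  fixes a t e :: "nat \<Rightarrow> real"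
  assumes a: "\<And>k. 0 \<le> a k" and t: "\<And>k. 0 \<le> t k" and e0: "\<And>k. 0 \<le> e k" and C: "0 \<le> C"
    and sum: "summable (\<lambda>k. t k * (a k)\<^sup>2)" and div: "\<not> summable t"
    and t0: "t \<longlonglongrightarrow> 0" and e: "summable e"
    and step: "\<And>k. a (Suc k) \<le> a k + C * t k * a k + e k"
  shows "a \<longlonglongrightarrow> 0"
proof -
  \<comment> \<open>The factor 2 gives strictness: the truncated sequence converges to some
    \<open>l \<le> c\<close>, and \<open>c < 2 * c\<close>.\<close>
  have ev: "\<forall>\<^sub>F k in sequentially. a k < 2 * c" if c: "0 < c" for c
  proof -
    let ?u = "\<lambda>k. max (a k) c"
    let ?e = "\<lambda>k. 2 * C / c * (t k * (a k)\<^sup>2) + e k"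
    have "(\<lambda>k. C * t k) \<longlonglongrightarrow> 0"
      using tendsto_mult_right_zero[OF t0] .
    then have "\<forall>\<^sub>F k in sequentially. C * t k < 1"
      by (rule order_tendstoD) simp
    then have "\<forall>\<^sub>F k in sequentially. ?u (Suc k) + 0 \<le> ?u k + ?e k"
    proof (rule eventually_mono)
      fix k assume Ct: "C * t k < 1"
      have nn: "0 \<le> C * t k" using C t by simp
      have e_nn: "0 \<le> 2 * C / c * (t k * (a k)\<^sup>2)" using C c t by simp
      \<comment> \<open>Below \<open>c / 2\<close>, \<open>C * t k < 1\<close> lets \<open>a\<close>
        at most double up to \<open>e k\<close>, so it cannot pass \<open>c\<close> by more than
        \<open>e k\<close>. From \<open>c / 2\<close> on,
        \<open>a k \<le> 2 / c * (a k)\<^sup>2\<close>, which explains the factor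
        \<open>2 * C / c\<close> in \<open>?e\<close>.\<close>
      show "?u (Suc k) + 0 \<le> ?u k + ?e k"
      proof (cases "a k < c / 2")
        case True
        have "C * t k * a k \<le> a k"
          using mult_right_mono[of "C * t k" 1 "a k"] Ct a by simp
        then show ?thesis using True step[of k] e_nn e0[of k] by linarith
      next
        case False
        then have "a k * 1 \<le> a k * (2 / c * a k)"
          using c a by (intro mult_left_mono) (auto simp: field_simps)
        then have "C * t k * a k \<le> C * t k * (2 / c * (a k)\<^sup>2)"
          using nn by (intro mult_left_mono) (auto simp: power2_eq_square algebra_simps)
        then have "C * t k * a k \<le> 2 * C / c * (t k * (a k)\<^sup>2)"
          by (simp add: algebra_simps)
        then show ?thesis using step[of k] e_nn e0[of k] by linarith
      qed
    qed
    moreover have "summable ?e"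
      using sum e by (intro summable_add summable_mult)
    ultimately have "convergent ?u"
      by (intro almost_decreasing_convergent[where b = "\<lambda>_. 0" and m = c and e = ?e]) auto
    then obtain l where l: "?u \<longlonglongrightarrow> l"
      unfolding convergent_def by blast
    \<comment> \<open>A limit above \<open>c\<close> would make the truncation inactive eventually,
      so that \<open>a k > c\<close> and \<open>t k\<close> is dominated by the summable
      \<open>t k * (a k)\<^sup>2 / c\<^sup>2\<close>.\<close>
    have "l \<le> c"
    proof (rule ccontr)
      assume "\<not> l \<le> c"
      then have "\<forall>\<^sub>F k in sequentially. c < ?u k"
        using l by (intro order_tendstoD) auto
      then have "\<forall>\<^sub>F k in sequentially. norm (t k) \<le> t k * (a k)\<^sup>2 / c\<^sup>2"
      proof (rule eventually_mono)
        fix k assume "c < ?u k"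
        then have "c\<^sup>2 \<le> (a k)\<^sup>2" using c by (intro power_mono) auto
        then have "t k * c\<^sup>2 \<le> t k * (a k)\<^sup>2"
          using t by (intro mult_left_mono) auto
        then show "norm (t k) \<le> t k * (a k)\<^sup>2 / c\<^sup>2"
          using c t by (simp add: field_simps)
      qed
      then have "summable t"
        by (rule summable_comparison_test_ev) (use sum summable_divide in blast)
      with div show False ..
    qed
    then have "\<forall>\<^sub>F k in sequentially. ?u k < 2 * c"
      using l c by (intro order_tendstoD) auto
    then show ?thesis by eventually_elim simp
  qed
  show ?thesis
  proof (rule order_tendstoI)
    show "\<forall>\<^sub>F k in sequentially. y < a k" if "y < 0" for y
      using that a by (auto intro: always_eventually less_le_trans)
    show "\<forall>\<^sub>F k in sequentially. a k < y" if "0 < y" for y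
      using ev[of "y / 2"] that by simp
  qed
qed

text \<open>The mean value theorem yields the constant \<open>L\<close> instead of the sharp \<open>L / 2\<close>, which suffices.\<close>

lemma L_smooth_descent:
  assumes "L_smooth L f"
  shows "f y \<le> f x + gradient f x \<bullet> (y - x) + L * (norm (y - x))\<^sup>2"
proof -
  let ?G = "gradient f" and ?p = "\<lambda>\<tau>::real. x + \<tau> *\<^sub>R (y - x)"
  have der: "((\<lambda>\<tau>. f (?p \<tau>)) has_real_derivative ?G (?p \<tau>) \<bullet> (y - x)) (at \<tau>)" for \<tau>
  proof -
    have "(f has_derivative (\<lambda>h. h \<bullet> ?G (?p \<tau>))) (at (?p \<tau>))"
      using assms GDERIV_gradient unfolding L_smooth_def gderiv_def by blast
    moreover have "(?p has_derivative (\<lambda>h. h *\<^sub>R (y - x))) (at \<tau>)"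
      by (auto intro!: derivative_eq_intros)
    ultimately have "((\<lambda>\<tau>. f (?p \<tau>)) has_derivative (\<lambda>h. (h *\<^sub>R (y - x)) \<bullet> ?G (?p \<tau>))) (at \<tau>)"
      by (rule has_derivative_compose[rotated])
    then show ?thesis
      by (simp add: has_field_derivative_def inner_commute mult.commute[of _ "_ \<bullet> _"])
  qed
  obtain \<tau> where \<tau>: "0 < \<tau>" "\<tau> < 1" "f (?p 1) - f (?p 0) = (1 - 0) * (?G (?p \<tau>) \<bullet> (y - x))"
    using MVT2[of 0 1 "\<lambda>\<tau>. f (?p \<tau>)" "\<lambda>\<tau>. ?G (?p \<tau>) \<bullet> (y - x)"] der by auto
  have L: "0 \<le> L" "norm (?G (?p \<tau>) - ?G x) \<le> L * norm (?p \<tau> - x)"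
    using assms unfolding L_smooth_def by blast+
  \<comment> \<open>The deviation from the linearization at \<open>x\<close> is the change of the
    gradient between \<open>x\<close> and the intermediate point, tested against
    \<open>y - x\<close>.\<close>
  have "(?G (?p \<tau>) - ?G x) \<bullet> (y - x) \<le> norm (?G (?p \<tau>) - ?G x) * norm (y - x)"
    by (rule norm_cauchy_schwarz)
  also have "\<dots> \<le> L * norm (y - x) * norm (y - x)"
  proof (rule mult_right_mono)
    have "L * norm (?p \<tau> - x) \<le> L * norm (y - x)"
      using \<tau> L(1) by (intro mult_left_mono) (auto simp: mult_left_le_one_le)
    with L(2) show "norm (?G (?p \<tau>) - ?G x) \<le> L * norm (y - x)" by linarith
  qed simp
  finally show ?thesis
    using \<tau>(3) by (simp add: inner_diff_left power2_eq_square mult.assoc)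
qed

text \<open>The descent condition supplies \<open>c1 * (norm v)\<^sup>2\<close> per unit of step
  size. The gradient error consumes a quarter of it by Young's inequality, the second-order term
  another quarter by the bound on \<open>\<tau>\<close>; half remains.\<close>

lemma L_smooth_inexact_step:
  assumes smooth: "L_smooth L f" and c: "0 < c1" "0 \<le> c2" and \<tau>: "0 \<le> \<tau>" "4 * L * c2\<^sup>2 * \<tau> \<le> c1"
    and descent: "c1 * (norm v)\<^sup>2 \<le> - (v \<bullet> d)" and bound: "norm d \<le> c2 * norm v"
    and err: "norm (v - gradient f x) \<le> \<epsilon>"
  shows "f (x + \<tau> *\<^sub>R d) + c1 / 2 * (\<tau> * (norm v)\<^sup>2) \<le> f x + \<tau> * (c2\<^sup>2 / c1 * \<epsilon>\<^sup>2)"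
proof -
  let ?a = "norm v"
  have L: "0 \<le> L" using smooth unfolding L_smooth_def by blast
  have \<epsilon>: "0 \<le> \<epsilon>" using err norm_ge_zero order_trans by blast
  have "(gradient f x - v) \<bullet> d \<le> norm (gradient f x - v) * norm d"
    by (rule norm_cauchy_schwarz)
  also have "\<dots> \<le> \<epsilon> * (c2 * ?a)"
    using err bound \<epsilon> by (intro mult_mono) (auto simp: norm_minus_commute)
  also have "\<dots> \<le> c1 / 4 * ?a\<^sup>2 + c2\<^sup>2 / c1 * \<epsilon>\<^sup>2"
  proof -
    \<comment> \<open>Young's inequality by completing the square, with weights chosen so that
      \<open>?a\<^sup>2\<close> gets the coefficient \<open>c1 / 4\<close>.\<close>
    have "0 \<le> (c1 * ?a - 2 * c2 * \<epsilon>)\<^sup>2 / (4 * c1)" using c by simp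
    also have "\<dots> = c1 / 4 * ?a\<^sup>2 + c2\<^sup>2 / c1 * \<epsilon>\<^sup>2 - \<epsilon> * (c2 * ?a)"
      using c by (simp add: field_simps power2_eq_square)
    finally show ?thesis by simp
  qed
  finally have "gradient f x \<bullet> d \<le> c2\<^sup>2 / c1 * \<epsilon>\<^sup>2 - 3 / 4 * c1 * ?a\<^sup>2"
    using descent by (simp add: inner_diff_left)
  moreover have "L * \<tau> * (norm d)\<^sup>2 \<le> c1 / 4 * ?a\<^sup>2"
  proof -
    have "(norm d)\<^sup>2 \<le> (c2 * ?a)\<^sup>2"
      using bound by (intro power_mono) auto
    then have "L * \<tau> * (norm d)\<^sup>2 \<le> L * \<tau> * (c2 * ?a)\<^sup>2"
      using L \<tau> by (intro mult_left_mono) auto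
    also have "\<dots> = (4 * L * c2\<^sup>2 * \<tau>) / 4 * ?a\<^sup>2"
      by (simp add: power_mult_distrib)
    also have "\<dots> \<le> c1 / 4 * ?a\<^sup>2"
      using \<tau> by (intro mult_right_mono) auto
    finally show ?thesis .
  qed
  ultimately have "gradient f x \<bullet> d + L * \<tau> * (norm d)\<^sup>2 \<le> c2\<^sup>2 / c1 * \<epsilon>\<^sup>2 - c1 / 2 * ?a\<^sup>2"
    by simp
  then have "\<tau> * (gradient f x \<bullet> d + L * \<tau> * (norm d)\<^sup>2) \<le> \<tau> * (c2\<^sup>2 / c1 * \<epsilon>\<^sup>2 - c1 / 2 * ?a\<^sup>2)"
    using \<tau> by (intro mult_left_mono) auto
  \<comment> \<open>The displacement is \<open>\<tau> *\<^sub>R d\<close>, so the quadratic term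
    carries \<open>\<tau>\<^sup>2\<close> and one factor \<open>\<tau>\<close> can be pulled
    out.\<close>
  moreover have "f (x + \<tau> *\<^sub>R d) \<le> f x + \<tau> * (gradient f x \<bullet> d + L * \<tau> * (norm d)\<^sup>2)"
    using L_smooth_descent[OF smooth, of "x + \<tau> *\<^sub>R d" x]
    by (simp add: power_mult_distrib power2_eq_square algebra_simps)
  ultimately show ?thesis
    by (simp add: algebra_simps)
qed

lemma L_smooth_isCont_gradient:
  assumes "L_smooth L f"
  shows "isCont (gradient f) x"
proof -
  have "L-lipschitz_on UNIV (gradient f)"
    using assms unfolding L_smooth_def by (intro lipschitz_onI) (auto simp: dist_norm)
  then show ?thesis
    using lipschitz_on_continuous_on continuous_on_eq_continuous_at open_UNIV by blast
qed

theorem theorem4p4: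
  fixes F :: "real ^ 'm \<Rightarrow> real"
    and L c1 c2 :: real
    and z s g :: "nat \<Rightarrow> real ^ 'm"
    and t \<delta> :: "nat \<Rightarrow> real"
  assumes "L_smooth L F"
    and "bdd_below (range F)"
    and "c1 > 0" and "c2 > 0"
    and "\<And>k. z (Suc k) = z k + t k *\<^sub>R s k"
    and "\<And>k. t k > 0"
    and "\<And>k. c1 * (norm (g k))\<^sup>2 \<le> - (g k \<bullet> s k)"
    and "\<And>k. norm (s k) \<le> c2 * norm (g k)"
    and "\<And>k. \<delta> k \<ge> 0" and "summable \<delta>"
    and "\<And>k. norm (g k - gradient F (z k)) \<le> \<delta> k"
    and "summable (\<lambda>k. (t k)\<^sup>2)"
    and "filterlim (\<lambda>n. \<Sum>k<n. t k) at_top sequentially"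
  shows "g \<longlonglongrightarrow> 0 \<and> (\<lambda>k. gradient F (z k)) \<longlonglongrightarrow> 0 \<and>
         (\<forall>x. seq_limit_point z x \<longrightarrow> stationary_point F x)"
proof -
  let ?G = "gradient F" and ?a = "\<lambda>k. norm (g k)"
  note z = assms(5) and t = assms(6) and \<delta> = assms(9) and err = assms(11)
  have t_nn: "\<And>k. 0 \<le> t k"
    using t by (rule less_imp_le)
  have L: "0 \<le> L" and G: "\<And>x y. norm (?G x - ?G y) \<le> L * norm (x - y)"
    using assms(1) unfolding L_smooth_def by auto
  obtain m where m: "\<And>x. m \<le> F x"
    using assms(2) unfolding bdd_below_def by blast
  have \<delta>0: "\<delta> \<longlonglongrightarrow> 0"
    using assms(10) by (rule summable_LIMSEQ_zero)
  have t0: "t \<longlonglongrightarrow> 0"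
    using tendsto_real_sqrt[OF summable_LIMSEQ_zero[OF assms(12)]] t_nn by simp
  \<comment> \<open>The quadratic error is \<open>\<delta> k\<close> times this null sequence, hence
    eventually at most \<open>\<delta> k\<close> and therefore summable.\<close>
  have "(\<lambda>k. t k * (c2\<^sup>2 / c1 * \<delta> k)) \<longlonglongrightarrow> 0"
    by (intro tendsto_mult_zero tendsto_mult_right_zero t0 \<delta>0)
  then have "\<forall>\<^sub>F k in sequentially. t k * (c2\<^sup>2 / c1 * \<delta> k) < 1"
    by (rule order_tendstoD) simp
  then have "\<forall>\<^sub>F k in sequentially. norm (t k * (c2\<^sup>2 / c1 * (\<delta> k)\<^sup>2)) \<le> \<delta> k"
  proof (rule eventually_mono)
    fix k assume "t k * (c2\<^sup>2 / c1 * \<delta> k) < 1"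
    then have "t k * (c2\<^sup>2 / c1 * \<delta> k) * \<delta> k \<le> 1 * \<delta> k"
      using \<delta> by (intro mult_right_mono) auto
    moreover have "0 \<le> t k * (c2\<^sup>2 / c1 * (\<delta> k)\<^sup>2)"
      using t[of k] assms(3) by simp
    ultimately show "norm (t k * (c2\<^sup>2 / c1 * (\<delta> k)\<^sup>2)) \<le> \<delta> k"
      by (simp add: power2_eq_square mult.assoc)
  qed
  then have err_sum: "summable (\<lambda>k. t k * (c2\<^sup>2 / c1 * (\<delta> k)\<^sup>2))"
    by (rule summable_comparison_test_ev) fact
  \<comment> \<open>The step size condition of \<open>L_smooth_inexact_step\<close> holds only from
    some index on, which is why \<open>almost_decreasing\<close> asks for its inequality only
    eventually.\<close>
  have "(\<lambda>k. 4 * L * c2\<^sup>2 * t k) \<longlonglongrightarrow> 0"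
    by (intro tendsto_mult_right_zero t0)
  then have "\<forall>\<^sub>F k in sequentially. 4 * L * c2\<^sup>2 * t k < c1"
    using assms(3) by (rule order_tendstoD)
  then have "\<forall>\<^sub>F k in sequentially.
      F (z (Suc k)) + c1 / 2 * (t k * (?a k)\<^sup>2) \<le> F (z k) + t k * (c2\<^sup>2 / c1 * (\<delta> k)\<^sup>2)"
  proof (rule eventually_mono)
    fix k assume "4 * L * c2\<^sup>2 * t k < c1"
    then show "F (z (Suc k)) + c1 / 2 * (t k * (?a k)\<^sup>2) \<le> F (z k) + t k * (c2\<^sup>2 / c1 * (\<delta> k)\<^sup>2)"
      unfolding z using assms(3,4) t[of k]
      by (intro L_smooth_inexact_step[OF assms(1) _ _ _ _ assms(7) assms(8) err]) auto
  qed
  then have "summable (\<lambda>k. c1 / 2 * (t k * (?a k)\<^sup>2))"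
    by (rule almost_decreasing_summable[where u = "\<lambda>k. F (z k)", OF _ _ err_sum m])
      (use assms(3) t_nn in auto)
  then have sum: "summable (\<lambda>k. t k * (?a k)\<^sup>2)"
    using assms(3) by (simp add: summable_cmult_iff)
  \<comment> \<open>Consecutive inexact gradients are compared through the exact ones: smoothness
    and the bound on \<open>s k\<close> give the constant \<open>L * c2\<close>, and each of the two
    exchanges costs one error, \<open>\<delta> k\<close> or \<open>\<delta> (Suc k)\<close>.\<close>
  have step: "?a (Suc k) \<le> ?a k + (L * c2) * t k * ?a k + (\<delta> k + \<delta> (Suc k))" for k
  proof -
    have "norm (?G (z (Suc k)) - ?G (z k)) \<le> L * (t k * norm (s k))"
      using G[of "z (Suc k)" "z k"] t[of k] by (simp add: z)
    also have "\<dots> \<le> L * (t k * (c2 * ?a k))"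
      using L t[of k] assms(8) by (intro mult_left_mono) auto
    finally have "norm (?G (z (Suc k)) - ?G (z k)) \<le> (L * c2) * t k * ?a k"
      by (simp add: ac_simps)
    moreover have "?a (Suc k) \<le> ?a k + norm (g (Suc k) - ?G (z (Suc k)))
        + norm (?G (z (Suc k)) - ?G (z k)) + norm (g k - ?G (z k))"
      by norm
    ultimately show ?thesis
      using err[of k] err[of "Suc k"] by simp
  qed
  have "?a \<longlonglongrightarrow> 0"
  proof (rule tendsto_zero_of_weighted_square_summable[OF _ _ _ _ sum _ t0 _ step])
    show "\<not> summable t"
      using assms(13) by (rule divergent_sum_not_summable)
    show "summable (\<lambda>k. \<delta> k + \<delta> (Suc k))"
      using assms(10) by (intro summable_add) (auto simp: summable_Suc_iff)
  qed (use L assms(4) t_nn \<delta> in auto)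
  then have g: "g \<longlonglongrightarrow> 0"
    by (rule tendsto_norm_zero_cancel)
  have "(\<lambda>k. g k - ?G (z k)) \<longlonglongrightarrow> 0"
    by (rule Lim_null_comparison[OF always_eventually \<delta>0]) (use err in blast)
  from tendsto_diff[OF g this] have Gz: "(\<lambda>k. ?G (z k)) \<longlonglongrightarrow> 0"
    by simp
  have "stationary_point F x" if lim: "seq_limit_point z x" for x
  proof -
    obtain r where r: "strict_mono r" "(z \<circ> r) \<longlonglongrightarrow> x"
      using lim unfolding seq_limit_point_def by blast
    \<comment> \<open>Along the subsequence the exact gradients tend to \<open>?G x\<close> by
      continuity and to zero as a subsequence of a null sequence.\<close>
    have "(\<lambda>k. ?G ((z \<circ> r) k)) \<longlonglongrightarrow> ?G x"
      using L_smooth_isCont_gradient[OF assms(1)] r(2) by (rule isCont_tendsto_compose)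
    moreover have "(\<lambda>k. ?G ((z \<circ> r) k)) \<longlonglongrightarrow> 0"
      using LIMSEQ_subseq_LIMSEQ[OF Gz r(1)] by (simp add: o_def)
    ultimately have "?G x = 0"
      by (rule LIMSEQ_unique)
    then show ?thesis
      using assms(1) unfolding stationary_point_def L_smooth_def by blast
  qed
  with g Gz show ?thesis by blast
qed

end
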